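(* Let $d\ge 2$ be an integer, and consider $\mathbb{C}^d\otimes\mathbb{C}^d\otimes\mathbb{C}^d$. Let $|\alpha_0\rangle=|000\rangle$ and let $\{|\alpha_j\rangle\}_{j=1}^{d^2}$ be an enumeration of $\mathcal{B}_1\cup\mathcal{B}_2\cup\mathcal{B}_3\cup\mathcal{B}_4\cup\mathcal{B}_5$, with $|\alpha_1\rangle=|100\rangle$, $|\alpha_2\rangle=|001\rangle$, $|\alpha_3\rangle=|010\rangle$, where \begin{itemize} \item $\mathcal{B}_1=\{|100\rangle,\ |001\rangle,\ |010\rangle\}$; \item $\mathcal{B}_2=\{\tfrac{1}{\sqrt2}(|0,0,i\rangle+|i-1,i-1,0\rangle) : 2\le i\le d-1\}$; \item $\mathcal{B}_3=\{\tfrac{1}{\sqrt2}(|0,i,0\rangle+|i-1,0,i-1\rangle) : 2\le i\le d-1\}$; \item $\mathcal{B}_4=\{\tfrac{1}{\sqrt2}(|0,i-1,i-1\rangle+|i,0,0\rangle) : 2\le i\le d-1\}$; \item $\mathcal{B}_5=\{\tfrac{1}{\sqrt3}(|0,i,j\rangle+|i,j,0\rangle+|j,0,i\rangle) : 1\le i,j\le d-1,\ (i,j)\notin\{(k,k):1\le k\le d-2\}\}$. \end{itemize} Define $|\psi_0\rangle=|\alpha_0\rangle$ and $|\psi_i\rangle=\sum_{j=1}^{d^2}\omega_{d^2}^{ij}|\alpha_j\rangle$ for $1\le i\le d^2$. Then $\{|\psi_i\rangle\}_{i=0}^{d^2}$ is a strongest nonlocal set of size $d^2+1$.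
   Context: $\omega_n=e^{2\pi\sqrt{-1}/n}$. $\{|0\rangle,\dots,|d-1\rangle\}$ is the computational (orthonormal) basis of $\mathbb{C}^d$, and $|a,b,c\rangle=|abc\rangle=|a\rangle\otimes|b\rangle\otimes|c\rangle$; the three tensor factors belong to parties $A$, $B$, $C$. States need not be normalized. A POVM on a Hilbert space $\mathcal{H}$ is a set of positive semidefinite operators $\{E_m=M_m^\dagger M_m\}$ with $\sum_m E_m=I_{\mathcal{H}}$; it is trivial if every $E_m$ is proportional to $I_{\mathcal{H}}$. Given a set $\{|\psi_i\rangle\}$ of mutually orthogonal multipartite states and a subset $X$ of the parties with complement $\overline{X}$, a POVM $\{E_m\}$ on the joint space of the parties in $X$ is an orthogonality-preserving local measurement (OPLM) if the post-measurement states stay mutually orthogonal, i.e. $\langle\psi_i|\,(I_{\overline{X}}\otimes E_m)\,|\psi_j\rangle=0$ for all $i\ne j$ and all $m$. A set of mutually orthogonal multipartite states is strongest nonlocal if, for every bipartition $X|\overline{X}$ of the parties (both sides nonempty), the only OPLMs on either side are trivial. (Equivalently: for every single party, the only OPLMs performed jointly by all the other parties are trivial.) *)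

theory Defs
  imports "HOL-Analysis.Analysis"
begin

text \<open>
  The parties are the elements of a finite type \<open>'p\<close>; party \<open>p\<close> holds a system of dimension
  \<open>D p\<close>.  The computational basis of the joint space of a set \<open>X\<close> of parties is indexed by
  the configurations of \<open>X\<close>, i.e. by a choice of a basis label for each party in \<open>X\<close>.
  Vectors and operators are given by their coordinates in this basis and vanish off the
  configurations, so that equality of functions is equality of vectors or operators.
\<close>

type_synonym 'p config = "'p \<Rightarrow> nat"
type_synonym 'p cvect = "'p config \<Rightarrow> complex"
type_synonym 'p coper = "'p config \<Rightarrow> 'p config \<Rightarrow> complex"

definition configs :: "('p \<Rightarrow> nat) \<Rightarrow> 'p set \<Rightarrow> 'p config set" where
  "configs D X = (\<Pi>\<^sub>E p\<in>X. {..<D p})"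

definition hilbert :: "('p \<Rightarrow> nat) \<Rightarrow> 'p set \<Rightarrow> 'p cvect set" where
  "hilbert D X = {v. \<forall>s. s \<notin> configs D X \<longrightarrow> v s = 0}"

definition braket :: "('p \<Rightarrow> nat) \<Rightarrow> 'p set \<Rightarrow> 'p cvect \<Rightarrow> 'p cvect \<Rightarrow> complex" where
  "braket D X u v = (\<Sum>s\<in>configs D X. cnj (u s) * v s)"

definition operators :: "('p \<Rightarrow> nat) \<Rightarrow> 'p set \<Rightarrow> 'p coper set" where
  "operators D X = {E. \<forall>s t. s \<notin> configs D X \<or> t \<notin> configs D X \<longrightarrow> E s t = 0}"

definition op_apply :: "('p \<Rightarrow> nat) \<Rightarrow> 'p set \<Rightarrow> 'p coper \<Rightarrow> 'p cvect \<Rightarrow> 'p cvect" where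
  "op_apply D X E v = (\<lambda>s. \<Sum>t\<in>configs D X. E s t * v t)"

definition id_op :: "('p \<Rightarrow> nat) \<Rightarrow> 'p set \<Rightarrow> 'p coper" where
  "id_op D X = (\<lambda>s t. if s = t \<and> s \<in> configs D X then 1 else 0)"

definition positive_semidefinite :: "('p \<Rightarrow> nat) \<Rightarrow> 'p set \<Rightarrow> 'p coper \<Rightarrow> bool" where
  "positive_semidefinite D X E \<longleftrightarrow>
     E \<in> operators D X \<and>
     (\<forall>v\<in>hilbert D X. braket D X v (op_apply D X E v) \<in> \<real>\<^sub>\<ge>\<^sub>0)"

text \<open>The operator \<open>E \<otimes> F\<close> for \<open>E\<close> on the parties \<open>X\<close> and \<open>F\<close> on the parties \<open>Y\<close>
  (used for disjoint \<open>X\<close> and \<open>Y\<close> only).\<close>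

definition tensor_op ::
    "('p \<Rightarrow> nat) \<Rightarrow> 'p set \<Rightarrow> 'p coper \<Rightarrow> 'p set \<Rightarrow> 'p coper \<Rightarrow> 'p coper" where
  "tensor_op D X E Y F = (\<lambda>s t.
     if s \<in> configs D (X \<union> Y) \<and> t \<in> configs D (X \<union> Y)
     then E (restrict s X) (restrict t X) * F (restrict s Y) (restrict t Y)
     else 0)"

text \<open>A POVM with \<open>n\<close> outcomes is the family \<open>E 0, \<dots>, E (n - 1)\<close>.\<close>

definition povm :: "('p \<Rightarrow> nat) \<Rightarrow> 'p set \<Rightarrow> nat \<Rightarrow> (nat \<Rightarrow> 'p coper) \<Rightarrow> bool" where
  "povm D X n E \<longleftrightarrow>
     (\<forall>m<n. positive_semidefinite D X (E m)) \<and>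
     (\<lambda>s t. \<Sum>m<n. E m s t) = id_op D X"

definition trivial_povm :: "('p \<Rightarrow> nat) \<Rightarrow> 'p set \<Rightarrow> nat \<Rightarrow> (nat \<Rightarrow> 'p coper) \<Rightarrow> bool" where
  "trivial_povm D X n E \<longleftrightarrow> (\<forall>m<n. \<exists>c. E m = (\<lambda>s t. c * id_op D X s t))"

definition orthogonal_states :: "('p::finite \<Rightarrow> nat) \<Rightarrow> 'p cvect set \<Rightarrow> bool" where
  "orthogonal_states D S \<longleftrightarrow>
     (\<forall>\<phi>\<in>S. \<phi> \<in> hilbert D UNIV \<and> \<phi> \<noteq> (\<lambda>s. 0)) \<and>
     (\<forall>\<phi>\<in>S. \<forall>\<psi>\<in>S. \<phi> \<noteq> \<psi> \<longrightarrow> braket D UNIV \<phi> \<psi> = 0)"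

definition oplm ::
    "('p::finite \<Rightarrow> nat) \<Rightarrow> 'p cvect set \<Rightarrow> 'p set \<Rightarrow> nat \<Rightarrow> (nat \<Rightarrow> 'p coper) \<Rightarrow> bool" where
  "oplm D S X n E \<longleftrightarrow>
     povm D X n E \<and>
     (\<forall>m<n. \<forall>\<phi>\<in>S. \<forall>\<psi>\<in>S. \<phi> \<noteq> \<psi> \<longrightarrow>
        braket D UNIV \<phi>
          (op_apply D UNIV (tensor_op D (- X) (id_op D (- X)) X (E m)) \<psi>) = 0)"

text \<open>Both sides of each bipartition are covered, since \<open>X\<close> ranges over all nonempty proper
  subsets of the parties.\<close>

definition strongest_nonlocal :: "('p::finite \<Rightarrow> nat) \<Rightarrow> 'p cvect set \<Rightarrow> bool" where
  "strongest_nonlocal D S \<longleftrightarrow>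
     orthogonal_states D S \<and>
     (\<forall>X. X \<noteq> {} \<and> X \<noteq> UNIV \<longrightarrow>
        (\<forall>n E. oplm D S X n E \<longrightarrow> trivial_povm D X n E))"

datatype party = Alice | Bob | Charlie

instance party :: finite
proof
  have "(UNIV :: party set) \<subseteq> {Alice, Bob, Charlie}"
    using party.exhaust by blast
  then show "finite (UNIV :: party set)"
    by (rule finite_subset) blast
qed

text \<open>The vector \<open>|a,b,c\<rangle> = |a\<rangle> \<otimes> |b\<rangle> \<otimes> |c\<rangle>\<close> is the basis vector of the configuration \<open>(a,b,c)\<close>.\<close>

definition ket :: "nat \<Rightarrow> nat \<Rightarrow> nat \<Rightarrow> party cvect" where
  "ket a b c = (\<lambda>s. if s Alice = a \<and> s Bob = b \<and> s Charlie = c then 1 else 0)"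

definition B1 :: "party cvect set" where
  "B1 = {ket 1 0 0, ket 0 0 1, ket 0 1 0}"

definition B2 :: "nat \<Rightarrow> party cvect set" where
  "B2 d = {\<lambda>s. 1 / complex_of_real (sqrt 2) * (ket 0 0 i s + ket (i - 1) (i - 1) 0 s)
           |i. 2 \<le> i \<and> i \<le> d - 1}"

definition B3 :: "nat \<Rightarrow> party cvect set" where
  "B3 d = {\<lambda>s. 1 / complex_of_real (sqrt 2) * (ket 0 i 0 s + ket (i - 1) 0 (i - 1) s)
           |i. 2 \<le> i \<and> i \<le> d - 1}"

definition B4 :: "nat \<Rightarrow> party cvect set" where
  "B4 d = {\<lambda>s. 1 / complex_of_real (sqrt 2) * (ket 0 (i - 1) (i - 1) s + ket i 0 0 s)
           |i. 2 \<le> i \<and> i \<le> d - 1}"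

definition B5 :: "nat \<Rightarrow> party cvect set" where
  "B5 d = {\<lambda>s. 1 / complex_of_real (sqrt 3) * (ket 0 i j s + ket i j 0 s + ket j 0 i s)
           |i j. 1 \<le> i \<and> i \<le> d - 1 \<and> 1 \<le> j \<and> j \<le> d - 1 \<and>
                  (i, j) \<notin> {(k, k) | k. 1 \<le> k \<and> k \<le> d - 2}}"

definition omega :: "nat \<Rightarrow> complex" where
  "omega n = exp (2 * complex_of_real pi * \<i> / of_nat n)"

definition fourier_state :: "nat \<Rightarrow> (nat \<Rightarrow> party cvect) \<Rightarrow> nat \<Rightarrow> party cvect" where
  "fourier_state d \<alpha> i =
     (if i = 0 then \<alpha> 0
      else (\<lambda>s. \<Sum>j = 1..d\<^sup>2. omega (d\<^sup>2) ^ (i * j) * \<alpha> j s))"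

end

theory Submission
  imports Defs
begin

text \<open>
  A nontrivial bipartition leaves some party \<open>p\<close> outside \<open>X\<close>, so it suffices to show that an operator
  \<open>F\<close> acting as the identity on \<open>p\<close> and preserving orthogonality of the \<open>\<psi>\<^sub>i\<close> is scalar.  All positions
  below are written with the label of \<open>p\<close> first.

  Inverting the Fourier transform in \<open>\<langle>\<alpha>\<^sub>0|F|\<psi>\<^sub>j\<rangle> = 0\<close> gives \<open>\<langle>000|F|\<alpha>\<^sub>l\<rangle> = 0\<close>, and since every label
  pair of the other two parties occurs next to \<open>0\<close> in some \<open>\<alpha>\<^sub>l\<close>, the whole row of \<open>F\<close> at \<open>000\<close> is
  diagonal.  By locality so is the row at \<open>100\<close>.  With \<open>c = \<langle>000|F|000\<rangle>\<close> and \<open>H = F - c I\<close> this means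
  \<open>\<langle>100|H = 0\<close>; expanding \<open>|100\<rangle>\<close>, itself one of the \<open>\<alpha>\<^sub>l\<close>, in the \<open>\<psi>\<^sub>i\<close> yields
  \<open>\<langle>\<psi>\<^sub>j|H|\<psi>\<^sub>j\<rangle> = 0\<close> for all \<open>j \<ge> 1\<close>, hence \<open>\<langle>\<alpha>\<^sub>k|H|\<alpha>\<^sub>l\<rangle> = 0\<close> for all \<open>k, l \<ge> 1\<close>.

  Apart from \<open>|100\<rangle>\<close>, each \<open>\<alpha>\<^sub>l\<close> is supported on one position \<open>0ij\<close> and on positions \<open>ab0\<close> or \<open>a0b\<close>
  with \<open>a \<ge> 1\<close>.  So each entry of \<open>H\<close> is minus a sum of entries between pairs of the form \<open>(m,0)\<close> or \<open>(0,m)\<close>,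
  and these vanish by induction on \<open>m\<close>.
\<close>

section \<open>Roots of unity and inversion of the discrete Fourier transform\<close>

lemma omega_power_eq_iff:
  assumes "n \<noteq> 0"
  shows "omega n ^ j = omega n ^ k \<longleftrightarrow> j mod n = k mod n"
proof -
  have "omega n ^ j = exp (2 * of_real pi * \<i> * of_nat j / of_nat n)" for j
    unfolding omega_def exp_of_nat_mult[symmetric] by (simp add: mult_ac)
  then show ?thesis
    using complex_root_unity_eq[of n j k] assms by simp
qed

lemma norm_omega: "norm (omega n) = 1"
  by (simp add: omega_def norm_exp_eq_Re)

text \<open>The summands are the powers of one \<open>n\<close>-th root of unity \<open>z\<close>,
  and \<open>z\<close> is 1 only for \<open>i = j\<close>; otherwise the geometric sum runs over a
  full period.\<close>

lemma sum_omega: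
  assumes "i \<in> {1..n}" "j \<in> {1..n}"
  shows "(\<Sum>k = 1..n. cnj (omega n ^ (i * k)) * omega n ^ (j * k)) = (if i = j then of_nat n else 0)"
proof -
  have n: "n \<noteq> 0"
    using assms by auto
  define z where "z = cnj (omega n ^ i) * omega n ^ j"
  have unit: "omega n ^ m * cnj (omega n ^ m) = 1" for m
    using complex_norm_square[of "omega n ^ m"] by (simp add: norm_omega norm_power)
  have root: "(omega n ^ m) ^ n = 1" for m
    using omega_power_eq_iff[OF n, of "m * n" 0] by (simp add: power_mult)
  have zn: "z ^ n = 1"
    using root[of i] root[of j] unfolding z_def
    by (simp add: power_mult_distrib del: complex_cnj_power flip: complex_cnj_power)
  have "(\<Sum>k = 1..n. cnj (omega n ^ (i * k)) * omega n ^ (j * k)) = (\<Sum>k = 1..n. z ^ k)"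
    by (simp add: z_def power_mult power_mult_distrib)
  also have "\<dots> = (if i = j then of_nat n else 0)"
  proof (cases "i = j")
    case True
    then have "z = 1"
      using unit[of j] by (simp add: z_def mult.commute)
    then show ?thesis
      using True by simp
  next
    case False
    have "z \<noteq> 1"
    proof
      assume "z = 1"
      then have "omega n ^ i * (cnj (omega n ^ i) * omega n ^ j) = omega n ^ i"
        by (simp add: z_def)
      then have "omega n ^ j = omega n ^ i"
        using unit[of i] by (metis mult.assoc mult_1)
      then have "j mod n = i mod n"
        using omega_power_eq_iff[OF n] by blast
      \<comment> \<open>Indices run from 1 to \<open>n\<close>, so \<open>n\<close> itself
        represents the residue 0.\<close>
      moreover have "m mod n = (if m = n then 0 else m)" if "m \<in> {1..n}" for m
        using that by auto
      ultimately show False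
        using False assms by (metis atLeastAtMost_iff not_one_le_zero)
    qed
    moreover have "(\<Sum>k = 1..n. z ^ k) = z * (\<Sum>k<n. z ^ k)"
      by (simp add: sum_distrib_left sum.atLeast1_atMost_eq)
    ultimately show ?thesis
      using False zn by (simp add: geometric_sum)
  qed
  finally show ?thesis .
qed

lemma dft_inj:
  assumes "\<And>i. i \<in> {1..n} \<Longrightarrow> (\<Sum>l = 1..n. omega n ^ (i * l) * m l) = 0"
    and k: "k \<in> {1..n}"
  shows "m k = 0"
proof -
  have "0 = (\<Sum>i = 1..n. cnj (omega n ^ (k * i)) * (\<Sum>l = 1..n. omega n ^ (i * l) * m l))"
    using assms by simp
  also have "\<dots> = (\<Sum>l = 1..n. (\<Sum>i = 1..n. cnj (omega n ^ (k * i)) * omega n ^ (l * i)) * m l)"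
    unfolding sum_distrib_left by (subst sum.swap) (simp add: sum_distrib_left sum_distrib_right mult_ac)
  also have "\<dots> = (\<Sum>l = 1..n. if k = l then of_nat n * m l else 0)"
    using k by (intro sum.cong refl) (subst sum_omega, auto)
  also have "\<dots> = of_nat n * m k"
    using k by (simp add: sum.delta)
  finally show ?thesis
    using k by auto
qed

lemma dft_cnj_inj:
  assumes "\<And>i. i \<in> {1..n} \<Longrightarrow> (\<Sum>l = 1..n. cnj (omega n ^ (i * l)) * m l) = 0"
    and "k \<in> {1..n}"
  shows "m k = 0"
proof -
  have "(\<Sum>l = 1..n. omega n ^ (i * l) * cnj (m l)) = 0" if "i \<in> {1..n}" for i
    using arg_cong[OF assms(1)[OF that], of cnj] by (simp add: cnj_sum)
  from dft_inj[OF this assms(2)] show ?thesis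
    by simp
qed

text \<open>The doubly transformed matrix \<open>P\<close> is only known to vanish off its diagonal.
  Inverting the transform at the zero row \<open>r\<close> gives, for each \<open>j\<close>, a
  vanishing combination of the entries \<open>P i j\<close> with nonzero weights; only
  \<open>P j j\<close> survives in it, so it vanishes too, and inverting both transforms kills
  \<open>M\<close>.\<close>

lemma dft_matrix_eq_0:
  fixes M :: "nat \<Rightarrow> nat \<Rightarrow> complex" and n :: nat
  defines "P \<equiv> \<lambda>i j. \<Sum>k = 1..n. \<Sum>l = 1..n. cnj (omega n ^ (i * k)) * omega n ^ (j * l) * M k l"
  assumes off: "\<And>i j. i \<in> {1..n} \<Longrightarrow> j \<in> {1..n} \<Longrightarrow> i \<noteq> j \<Longrightarrow> P i j = 0"
    and r: "r \<in> {1..n}" and row: "\<And>l. l \<in> {1..n} \<Longrightarrow> M r l = 0"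
    and kl: "k \<in> {1..n}" "l \<in> {1..n}"
  shows "M k l = 0"
proof -
  define R where "R i l = (\<Sum>k = 1..n. cnj (omega n ^ (i * k)) * M k l)" for i l
  have PR: "P i j = (\<Sum>l = 1..n. omega n ^ (j * l) * R i l)" for i j
    unfolding P_def R_def by (subst sum.swap) (simp add: sum_distrib_left mult_ac)
  have Rr: "(\<Sum>i = 1..n. omega n ^ (i * r) * R i l) = 0" if "l \<in> {1..n}" for l
  proof -
    have "(\<Sum>i = 1..n. omega n ^ (i * r) * R i l)
        = (\<Sum>k = 1..n. (\<Sum>i = 1..n. cnj (omega n ^ (k * i)) * omega n ^ (r * i)) * M k l)"
      unfolding R_def sum_distrib_left
      by (subst sum.swap) (simp add: sum_distrib_left sum_distrib_right mult_ac)
    also have "\<dots> = (\<Sum>k = 1..n. if k = r then of_nat n * M k l else 0)"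
      using r by (intro sum.cong refl) (subst sum_omega, auto)
    also have "\<dots> = 0"
      using row[OF that] by (simp add: sum.delta)
    finally show ?thesis .
  qed
  have diag: "P j j = 0" if j: "j \<in> {1..n}" for j
  proof -
    have "(\<Sum>i = 1..n. omega n ^ (i * r) * P i j)
        = (\<Sum>l = 1..n. omega n ^ (j * l) * (\<Sum>i = 1..n. omega n ^ (i * r) * R i l))"
      unfolding PR sum_distrib_left by (subst sum.swap) (simp add: mult_ac)
    also have "\<dots> = 0"
      using Rr by simp
    finally have "(\<Sum>i = 1..n. omega n ^ (i * r) * P i j) = 0" .
    moreover have "(\<Sum>i = 1..n. omega n ^ (i * r) * P i j)
        = (\<Sum>i = 1..n. if i = j then omega n ^ (j * r) * P j j else 0)"
      using off j by (intro sum.cong refl) auto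
    ultimately have "omega n ^ (j * r) * P j j = 0"
      using j by (simp add: sum.delta)
    then show ?thesis
      by (simp add: omega_def)
  qed
  have "P i j = 0" if "i \<in> {1..n}" "j \<in> {1..n}" for i j
    using off diag that by blast
  then have "R i l = 0" if "i \<in> {1..n}" for i
    using dft_inj[of n "R i"] that kl by (simp add: PR)
  then show ?thesis
    using dft_cnj_inj[of n "\<lambda>k. M k l"] kl by (simp add: R_def)
qed

section \<open>Coordinates from the viewpoint of one party\<close>

text \<open>The other two parties follow in the cyclic order Alice, Bob, Charlie, so that changing
  the viewpoint amounts to rotating the triple.\<close>

fun cfg :: "party \<Rightarrow> nat \<times> nat \<times> nat \<Rightarrow> party config" where
  "cfg Alice (a, b, c) = case_party a b c"
| "cfg Bob (a, b, c) = case_party c a b"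
| "cfg Charlie (a, b, c) = case_party b c a"

lemma cfg_same [simp]: "cfg p (a, b, c) p = a"
  by (cases p) auto

lemma fun_upd_cfg: "(cfg p (a, b, c))(p := x) = cfg p (x, b, c)"
  by (cases p) (auto simp: fun_eq_iff split: party.split)

lemma case_party_eq_iff:
  "case_party a b c = case_party a' b' c' \<longleftrightarrow> a = a' \<and> b = b' \<and> c = c'"
  by (metis party.case)

lemma inj_cfg: "inj (cfg p)"
  by (cases p) (auto intro!: injI simp: case_party_eq_iff)

lemma cfg_eq_iff [simp]: "cfg p x = cfg p y \<longleftrightarrow> x = y"
  using inj_cfg by (auto dest: injD)

lemma cfg_cases: obtains a b c where "s = cfg p (a, b, c)"
proof -
  have s: "s = case_party (s Alice) (s Bob) (s Charlie)"
    by (auto simp: fun_eq_iff split: party.split)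
  show ?thesis
  proof (cases p)
    case Alice
    show ?thesis
      by (rule that[of "s Alice" "s Bob" "s Charlie"]) (use s Alice in simp)
  next
    case Bob
    show ?thesis
      by (rule that[of "s Bob" "s Charlie" "s Alice"]) (use s Bob in simp)
  next
    case Charlie
    show ?thesis
      by (rule that[of "s Charlie" "s Alice" "s Bob"]) (use s Charlie in simp)
  qed
qed

lemma all_party: "(\<forall>p. P p) \<longleftrightarrow> P Alice \<and> P Bob \<and> P Charlie"
  by (metis party.exhaust)

lemma configs_UNIV: "configs D UNIV = {s. \<forall>p. s p < D p}"
  by (auto simp: configs_def)

lemma cfg_in_configs [simp]:
  "cfg p (a, b, c) \<in> configs (\<lambda>_. d) UNIV \<longleftrightarrow> a < d \<and> b < d \<and> c < d"
  by (cases p) (auto simp: configs_UNIV all_party)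

lemma finite_configs [simp]: "finite X \<Longrightarrow> finite (configs D X)"
  by (simp add: configs_def finite_PiE)

declare cfg.simps [simp del]

section \<open>Supports of the states and their symmetry\<close>

text \<open>
  \<open>block d i j\<close> is the support of the state whose position with label \<open>0\<close> for the first party is
  \<open>(0, i, j)\<close>; the free index \<open>i = j = 0\<close> is assigned to the state \<open>|100\<rangle>\<close>, which has no such position.
  The family is invariant under rotation, so the description is the same from every party's view.
\<close>

definition tail :: "nat \<Rightarrow> nat \<Rightarrow> nat \<Rightarrow> (nat \<times> nat \<times> nat) set" where
  "tail d i j =
    (if i = 0 then (if j \<le> 1 then {} else {(j - 1, j - 1, 0)})
     else if j = 0 then (if i \<le> 1 then {} else {(i - 1, 0, i - 1)})
     else if i = j \<and> i < d - 1 then {(i + 1, 0, 0)}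
     else {(i, j, 0), (j, 0, i)})"

definition block :: "nat \<Rightarrow> nat \<Rightarrow> nat \<Rightarrow> (nat \<times> nat \<times> nat) set" where
  "block d i j = (if i = 0 \<and> j = 0 then {(1, 0, 0)} else insert (0, i, j) (tail d i j))"

lemma fst_tail: "x \<in> tail d i j \<Longrightarrow> fst x \<noteq> 0"
  by (auto simp: tail_def split: if_splits)

lemma finite_block [simp]: "finite (block d i j)"
  by (simp add: block_def tail_def)

text \<open>A position determines its index. The delicate positions are the degenerate ones: for
  \<open>a\<close> at least 1, \<open>(a, a, 0)\<close> lies in the block of
  \<open>(0, a + 1)\<close> if \<open>a < d - 1\<close>, but in the triple of
  \<open>(d - 1, d - 1)\<close> if \<open>a = d - 1\<close>; likewise for
  \<open>(a, 0, a)\<close>.\<close>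

lemma block_disjoint:
  assumes "i < d" "j < d" "i' < d" "j' < d" "x \<in> block d i j" "x \<in> block d i' j'"
  shows "i = i' \<and> j = j'"
  using assms by (auto simp: block_def tail_def split: if_splits)

lemma block_subset:
  "i < d \<Longrightarrow> j < d \<Longrightarrow> 2 \<le> d \<Longrightarrow> block d i j \<subseteq> {..<d} \<times> {..<d} \<times> {..<d}"
  by (auto simp: block_def tail_def split: if_splits)

text \<open>The first three cases are \<open>B1\<close>, the other four are \<open>B2\<close>,
  \<open>B3\<close>, \<open>B4\<close>, \<open>B5\<close> in this order, with the parameter of
  \<open>B4\<close> lowered by one.\<close>

lemma block_cases:
  assumes "i < d" "j < d"
  obtains "i = 0" "j = 0" "block d i j = {(1, 0, 0)}"
    | "i = 0" "j = 1" "block d i j = {(0, 0, 1)}"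
    | "i = 1" "j = 0" "block d i j = {(0, 1, 0)}"
    | "i = 0" "2 \<le> j" "j \<le> d - 1" "block d i j = {(0, 0, j), (j - 1, j - 1, 0)}"
    | "j = 0" "2 \<le> i" "i \<le> d - 1" "block d i j = {(0, i, 0), (i - 1, 0, i - 1)}"
    | "1 \<le> i" "i = j" "i < d - 1" "block d i j = {(0, i, i), (i + 1, 0, 0)}"
    | "1 \<le> i" "i \<le> d - 1" "1 \<le> j" "j \<le> d - 1" "i \<noteq> j \<or> i = d - 1"
      "block d i j = {(0, i, j), (i, j, 0), (j, 0, i)}"
proof -
  consider "i = 0" "j = 0" | "i = 0" "j = 1" | "i = 1" "j = 0" | "i = 0" "j \<ge> 2" | "i \<ge> 2" "j = 0"
    | "1 \<le> i" "i = j" "i < d - 1" | "1 \<le> i" "1 \<le> j" "\<not> (i = j \<and> i < d - 1)"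
    by (cases "i = 0"; cases "j = 0"; cases "i = 1"; cases "j = 1"; cases "i = j \<and> i < d - 1"; simp)
  then show ?thesis
  proof cases
    case 1
    then show ?thesis by (intro that(1)) (simp_all add: block_def)
  next
    case 2
    then show ?thesis by (intro that(2)) (simp_all add: block_def tail_def)
  next
    case 3
    then show ?thesis by (intro that(3)) (simp_all add: block_def tail_def)
  next
    case 4
    then show ?thesis using assms by (intro that(4)) (simp_all add: block_def tail_def)
  next
    case 5
    then show ?thesis using assms by (intro that(5)) (simp_all add: block_def tail_def)
  next
    case 6
    then show ?thesis by (intro that(6)) (simp_all add: block_def tail_def)
  next
    case 7
    then have "block d i j = {(0, i, j), (i, j, 0), (j, 0, i)}"
      by (cases "i = j") (simp_all add: block_def tail_def)
    moreover have "i \<le> d - 1" "j \<le> d - 1" "i \<noteq> j \<or> i = d - 1"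
      using 7 assms by auto
    ultimately show ?thesis using 7 by (intro that(7))
  qed
qed

text \<open>Rotation cycles the three states of \<open>B1\<close>, sends \<open>B2\<close> to
  \<open>B4\<close>, \<open>B4\<close> to \<open>B3\<close> and \<open>B3\<close> to
  \<open>B2\<close>, and fixes each block of \<open>B5\<close>.\<close>

lemma block_rotate:
  assumes "2 \<le> d" "i < d" "j < d"
  shows "\<exists>i' j'. i' < d \<and> j' < d \<and> (\<lambda>(a, b, c). (c, a, b)) ` block d i j = block d i' j'"
  using assms(2,3)
proof (cases rule: block_cases)
  case 1
  then show ?thesis
    using assms unfolding 1(3)
    by (intro exI[of _ 1] exI[of _ 0]) (simp add: block_def tail_def insert_commute)
next
  case 2
  then show ?thesis
    using assms unfolding 2(3)
    by (intro exI[of _ 0] exI[of _ 0]) (simp add: block_def tail_def insert_commute)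
next
  case 3
  then show ?thesis
    using assms unfolding 3(3)
    by (intro exI[of _ 0] exI[of _ 1]) (simp add: block_def tail_def insert_commute)
next
  case 4
  then show ?thesis
    using assms unfolding 4(4)
    by (intro exI[of _ "j - 1"] exI[of _ "j - 1"]) (simp add: block_def tail_def insert_commute, arith)
next
  case 5
  then show ?thesis
    using assms unfolding 5(4)
    by (intro exI[of _ 0] exI[of _ i]) (simp add: block_def tail_def insert_commute)
next
  case 6
  then show ?thesis
    using assms unfolding 6(4)
    by (intro exI[of _ "i + 1"] exI[of _ 0]) (simp add: block_def tail_def insert_commute)
next
  case 7
  then show ?thesis
    using assms unfolding 7(6)
    by (intro exI[of _ i] exI[of _ j]) (cases "i = j"; simp add: block_def tail_def insert_commute)
qed

section \<open>Vanishing of a local matrix all of whose block sums vanish\<close>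

text \<open>\<open>h\<close> is the identity on the first label tensored with \<open>g\<close>. A
  block other than that of \<open>(0, 0)\<close> has exactly one position with first label 0, so a
  block sum is one entry of \<open>g\<close> plus a sum over tails, which only involves label pairs
  containing a zero.\<close>

lemma block_sums_eq_0:
  fixes g :: "nat \<Rightarrow> nat \<Rightarrow> nat \<Rightarrow> nat \<Rightarrow> complex" and d :: nat
  defines "h \<equiv> \<lambda>(a, b, c) (a', b', c'). if a = a' then g b c b' c' else 0"
  assumes blocks: "\<And>i j i' j'. \<lbrakk>i < d; j < d; i' < d; j' < d\<rbrakk> \<Longrightarrow>
      (\<Sum>x\<in>block d i j. \<Sum>y\<in>block d i' j'. h x y) = 0"
    and g0: "\<And>i j. \<lbrakk>i < d; j < d\<rbrakk> \<Longrightarrow> g 0 0 i j = 0" "\<And>i j. \<lbrakk>i < d; j < d\<rbrakk> \<Longrightarrow> g i j 0 0 = 0"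
    and less: "i < d" "j < d" "i' < d" "j' < d"
  shows "g i j i' j' = 0"
proof -
  have eq: "g i j i' j' + (\<Sum>x\<in>tail d i j. \<Sum>y\<in>tail d i' j'. h x y) = 0"
    if "i < d" "j < d" "i' < d" "j' < d" "(i, j) \<noteq> (0, 0)" "(i', j') \<noteq> (0, 0)" for i j i' j'
  proof -
    have fin: "finite (tail d i j)" for i j
      by (simp add: tail_def)
    have notin: "(0, k, l) \<notin> tail d i j" for i j k l
      using fst_tail by fastforce
    have cross: "h (0, k, l) x = 0" "h x (0, k, l) = 0" if "x \<in> tail d i j" for x i j k l
      using fst_tail[OF that] by (auto simp: h_def split: prod.split)
    have "block d i j = insert (0, i, j) (tail d i j)" "block d i' j' = insert (0, i', j') (tail d i' j')"
      using that(5,6) by (auto simp: block_def)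
    then have "(\<Sum>x\<in>block d i j. \<Sum>y\<in>block d i' j'. h x y)
        = h (0, i, j) (0, i', j') + (\<Sum>x\<in>tail d i j. \<Sum>y\<in>tail d i' j'. h x y)"
      by (simp add: fin notin cross sum.distrib)
    then show ?thesis
      using blocks[OF that(1-4)] by (simp add: h_def)
  qed
  \<comment> \<open>Tails attached to the labels \<open>Suc m\<close> and \<open>n\<close> have
    first labels \<open>m\<close> and \<open>n - 1\<close>. They interact only for
    \<open>n = Suc m\<close>, and then through an entry given by the induction hypothesis at
    \<open>n = m\<close>; for \<open>m = 0\<close> the tail is empty.\<close>
  have axis: "g 0 m 0 n = 0 \<and> g 0 m n 0 = 0 \<and> g m 0 0 n = 0 \<and> g m 0 n 0 = 0"
    if "m < d" "n < d" for m n
    using that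
  proof (induction m arbitrary: n)
    case 0
    then show ?case
      using g0 by simp
  next
    case (Suc m)
    show ?case
    proof (cases "n = 0")
      case True
      then show ?thesis
        using g0 Suc.prems by simp
    next
      case False
      have 1: "0 < d"
        using Suc.prems by simp
      have "(m, m, 0) \<noteq> (n - 1, 0, n - 1) \<or> n = Suc m" using False by auto
      then show ?thesis
        using eq[of 0 "Suc m" 0 n] eq[of 0 "Suc m" n 0] eq[of "Suc m" 0 0 n] eq[of "Suc m" 0 n 0]
          Suc.IH[of m] Suc.prems False 1
        by (auto simp: tail_def h_def split: if_splits)
    qed
  qed
  \<comment> \<open>A tail position has the form \<open>(a, b, 0)\<close> or
    \<open>(a, 0, b)\<close>, so only entries covered by \<open>axis\<close> occur.\<close>
  have tail0: "h x y = 0" if "x \<in> tail d i j" "y \<in> tail d i' j'" for x y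
    using that less axis by (auto simp: tail_def h_def split: if_splits)
  show ?thesis
  proof (cases "(i, j) = (0, 0) \<or> (i', j') = (0, 0)")
    case True
    then show ?thesis
      using g0 less by auto
  next
    case False
    then show ?thesis
      using eq[OF less] tail0 by simp
  qed
qed

section \<open>The given states as normalized indicators of blocks\<close>

text \<open>A state is recorded by its support alone; the factors 1, 1/sqrt 2 and 1/sqrt 3 are
  recovered from the size of the support.\<close>

definition uniform :: "'p config set \<Rightarrow> 'p cvect" where
  "uniform P = (\<lambda>s. of_bool (s \<in> P) / of_real (sqrt (card P)))"

lemma card_cfg_image [simp]: "card (cfg p ` T) = card T"
  using inj_cfg by (metis card_image inj_on_subset subset_UNIV)

lemma ket_eq: "ket a b c = (\<lambda>s. of_bool (s = cfg Alice (a, b, c)))"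
  by (auto simp: ket_def fun_eq_iff all_party cfg.simps)

lemma uniform_cfg_pair:
  assumes "x \<noteq> y"
  shows "uniform (cfg p ` {x, y})
    = (\<lambda>s. 1 / of_real (sqrt 2) * (of_bool (s = cfg p x) + of_bool (s = cfg p y)))"
proof
  have "card (cfg p ` {x, y}) = 2"
    using assms unfolding card_cfg_image by simp
  then show "uniform (cfg p ` {x, y}) s
    = 1 / of_real (sqrt 2) * (of_bool (s = cfg p x) + of_bool (s = cfg p y))" for s
    using assms by (simp add: uniform_def of_bool_def)
qed

lemma uniform_cfg_triple:
  assumes "x \<noteq> y" "x \<noteq> z" "y \<noteq> z"
  shows "uniform (cfg p ` {x, y, z})
    = (\<lambda>s. 1 / of_real (sqrt 3) * (of_bool (s = cfg p x) + of_bool (s = cfg p y) + of_bool (s = cfg p z)))"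
proof
  have "card (cfg p ` {x, y, z}) = 3"
    using assms unfolding card_cfg_image by simp
  then show "uniform (cfg p ` {x, y, z}) s
    = 1 / of_real (sqrt 3) * (of_bool (s = cfg p x) + of_bool (s = cfg p y) + of_bool (s = cfg p z))" for s
    using assms by (simp add: uniform_def of_bool_def)
qed

lemma B1_eq: "B1 = {uniform (cfg Alice ` {(1, 0, 0)}), uniform (cfg Alice ` {(0, 0, 1)}),
    uniform (cfg Alice ` {(0, 1, 0)})}"
  by (simp add: B1_def uniform_def ket_eq)

lemma B2_eq: "B2 d = {uniform (cfg Alice ` {(0, 0, i), (i - 1, i - 1, 0)}) | i. 2 \<le> i \<and> i \<le> d - 1}"
  unfolding B2_def
  by (intro Collect_cong ex_cong1 rev_conj_cong refl) (subst uniform_cfg_pair, simp, simp only: ket_eq)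

lemma B3_eq: "B3 d = {uniform (cfg Alice ` {(0, i, 0), (i - 1, 0, i - 1)}) | i. 2 \<le> i \<and> i \<le> d - 1}"
  unfolding B3_def
  by (intro Collect_cong ex_cong1 rev_conj_cong refl) (subst uniform_cfg_pair, simp, simp only: ket_eq)

lemma B4_eq: "B4 d = {uniform (cfg Alice ` {(0, i - 1, i - 1), (i, 0, 0)}) | i. 2 \<le> i \<and> i \<le> d - 1}"
  unfolding B4_def
  by (intro Collect_cong ex_cong1 rev_conj_cong refl) (subst uniform_cfg_pair, simp, simp only: ket_eq)

lemma B5_eq: "B5 d = {uniform (cfg Alice ` {(0, i, j), (i, j, 0), (j, 0, i)}) | i j.
    1 \<le> i \<and> i \<le> d - 1 \<and> 1 \<le> j \<and> j \<le> d - 1 \<and> (i, j) \<notin> {(k, k) | k. 1 \<le> k \<and> k \<le> d - 2}}"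
  unfolding B5_def
  by (intro Collect_cong ex_cong1 rev_conj_cong refl)
    (subst uniform_cfg_triple, simp, simp, simp, simp only: ket_eq)

text \<open>Merges the five families into one indexed by pairs. The diagonal pairs excluded from
  \<open>B5\<close> are filled by \<open>B4\<close>, and the pair \<open>(0, 0)\<close> by the state
  \<open>ket 1 0 0\<close>.\<close>

lemma states_eq_uniform:
  assumes "2 \<le> d"
  shows "B1 \<union> B2 d \<union> B3 d \<union> B4 d \<union> B5 d
    = {uniform (cfg Alice ` block d i j) | i j. i < d \<and> j < d}" (is "?B = ?U")
proof
  have mem: "uniform (cfg Alice ` T) \<in> ?U" if "i < d" "j < d" "block d i j = T" for T i j
    using that by blast
  have "B1 \<subseteq> ?U"
    unfolding B1_eq insert_subset using assms
    by (intro conjI mem[of 0 0 "{(1, 0, 0)}"] mem[of 0 1 "{(0, 0, 1)}"] mem[of 1 0 "{(0, 1, 0)}"])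
      (simp_all add: block_def tail_def)
  moreover have "B2 d \<subseteq> ?U"
  proof
    fix v assume "v \<in> B2 d"
    then obtain i where "2 \<le> i" "i \<le> d - 1" and v: "v = uniform (cfg Alice ` {(0, 0, i), (i - 1, i - 1, 0)})"
      unfolding B2_eq by blast
    then show "v \<in> ?U"
      unfolding v by (intro mem[of 0 i]) (simp_all add: block_def tail_def)
  qed
  moreover have "B3 d \<subseteq> ?U"
  proof
    fix v assume "v \<in> B3 d"
    then obtain i where "2 \<le> i" "i \<le> d - 1" and v: "v = uniform (cfg Alice ` {(0, i, 0), (i - 1, 0, i - 1)})"
      unfolding B3_eq by blast
    then show "v \<in> ?U"
      unfolding v by (intro mem[of i 0]) (simp_all add: block_def tail_def)
  qed
  moreover have "B4 d \<subseteq> ?U"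
  proof
    fix v assume "v \<in> B4 d"
    then obtain i where "2 \<le> i" "i \<le> d - 1" and v: "v = uniform (cfg Alice ` {(0, i - 1, i - 1), (i, 0, 0)})"
      unfolding B4_eq by blast
    then show "v \<in> ?U"
      unfolding v by (intro mem[of "i - 1" "i - 1"]) (simp_all add: block_def tail_def)
  qed
  moreover have "B5 d \<subseteq> ?U"
  proof
    fix v assume "v \<in> B5 d"
    then obtain i j where "1 \<le> i" "i \<le> d - 1" "1 \<le> j" "j \<le> d - 1" "\<not> (i = j \<and> i \<le> d - 2)"
      and v: "v = uniform (cfg Alice ` {(0, i, j), (i, j, 0), (j, 0, i)})"
      unfolding B5_eq by blast
    moreover from this have "\<not> (i = j \<and> i < d - 1)"
      by linarith
    ultimately show "v \<in> ?U"
      unfolding v by (intro mem[of i j]) (simp_all add: block_def tail_def del: de_Morgan_conj)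
  qed
  ultimately show "?B \<subseteq> ?U"
    by simp
next
  show "?U \<subseteq> ?B"
  proof
    fix v assume "v \<in> ?U"
    then obtain i j where ij: "i < d" "j < d" and v: "v = uniform (cfg Alice ` block d i j)"
      by blast
    show "v \<in> ?B"
      using ij
    proof (cases rule: block_cases)
      case 1
      have "v \<in> B1"
        unfolding v 1(3) B1_eq by simp
      then show ?thesis by blast
    next
      case 2
      have "v \<in> B1"
        unfolding v 2(3) B1_eq by simp
      then show ?thesis by blast
    next
      case 3
      have "v \<in> B1"
        unfolding v 3(3) B1_eq by simp
      then show ?thesis by blast
    next
      case 4
      then have "v \<in> B2 d"
        unfolding v 4(4) B2_eq mem_Collect_eq by (intro exI[of _ j] conjI refl)
      then show ?thesis by blast
    next
      case 5
      then have "v \<in> B3 d"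
        unfolding v 5(4) B3_eq mem_Collect_eq by (intro exI[of _ i] conjI refl)
      then show ?thesis by blast
    next
      case 6
      have "v \<in> B4 d"
        unfolding v 6(4) B4_eq mem_Collect_eq
        by (intro exI[of _ "i + 1"]) (use 6 in simp)
      then show ?thesis by blast
    next
      case 7
      have "\<not> (i = j \<and> i \<le> d - 2)"
        using 7(1,5) ij by linarith
      then have "(i, j) \<notin> {(k, k) | k. 1 \<le> k \<and> k \<le> d - 2}"
        by blast
      then have "v \<in> B5 d"
        using 7(1-4) unfolding v 7(6) B5_eq mem_Collect_eq by (intro exI[of _ i] exI[of _ j] conjI refl)
      then show ?thesis by blast
    qed
  qed
qed

text \<open>Passing from Alice to another party rotates the triples once or twice, and
  \<open>block_rotate\<close> absorbs this. Hence the later argument can be run with any party in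
  the leading place.\<close>

lemma uniform_cfg_block_in_states:
  assumes "2 \<le> d" "i < d" "j < d"
  shows "uniform (cfg p ` block d i j) \<in> B1 \<union> B2 d \<union> B3 d \<union> B4 d \<union> B5 d"
proof -
  define rot :: "nat \<times> nat \<times> nat \<Rightarrow> nat \<times> nat \<times> nat" where "rot = (\<lambda>(a, b, c). (c, a, b))"
  have rot: "\<exists>i' j'. i' < d \<and> j' < d \<and> rot ` block d i j = block d i' j'" if "i < d" "j < d" for i j
    using block_rotate[OF assms(1) that] by (simp add: rot_def)
  have "cfg Bob x = cfg Alice (rot x)" "cfg Charlie x = cfg Alice (rot (rot x))" for x
    by (cases x, simp add: rot_def cfg.simps)+
  then have img: "cfg Bob ` T = cfg Alice ` rot ` T" "cfg Charlie ` T = cfg Alice ` rot ` rot ` T" for T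
    by (simp_all add: image_image)
  have "\<exists>i' j'. i' < d \<and> j' < d \<and> cfg p ` block d i j = cfg Alice ` block d i' j'"
    using rot assms(2,3) by (cases p) (metis img)+
  then show ?thesis
    unfolding states_eq_uniform[OF assms(1)] mem_Collect_eq by metis
qed

section \<open>Brackets and operators on indicators, sums and scalar shifts\<close>

lemma op_apply_uniform:
  assumes "finite X" "Q \<subseteq> configs D X"
  shows "op_apply D X F (uniform Q) s = (\<Sum>t\<in>Q. F s t) / of_real (sqrt (card Q))"
proof -
  have "op_apply D X F (uniform Q) s
      = (\<Sum>t\<in>configs D X. if t \<in> Q then F s t / of_real (sqrt (card Q)) else 0)"
    unfolding op_apply_def uniform_def by (intro sum.cong) auto
  also have "\<dots> = (\<Sum>t\<in>Q. F s t / of_real (sqrt (card Q)))"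
    using assms by (simp add: sum.inter_restrict[symmetric] Int_absorb1)
  finally show ?thesis
    by (simp add: sum_divide_distrib)
qed

lemma braket_uniform:
  assumes "finite X" "P \<subseteq> configs D X"
  shows "braket D X (uniform P) v = (\<Sum>s\<in>P. v s) / of_real (sqrt (card P))"
proof -
  have "braket D X (uniform P) v
      = (\<Sum>s\<in>configs D X. if s \<in> P then v s / of_real (sqrt (card P)) else 0)"
    unfolding braket_def uniform_def by (intro sum.cong) auto
  also have "\<dots> = (\<Sum>s\<in>P. v s / of_real (sqrt (card P)))"
    using assms by (simp add: sum.inter_restrict[symmetric] Int_absorb1)
  finally show ?thesis
    by (simp add: sum_divide_distrib)
qed

lemma braket_uniform_uniform:
  assumes "finite X" "P \<subseteq> configs D X"
  shows "braket D X (uniform P) (uniform Q)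
    = of_nat (card (P \<inter> Q)) / (of_real (sqrt (card P)) * of_real (sqrt (card Q)))"
proof -
  have "finite P"
    using assms finite_configs finite_subset by blast
  then have "(\<Sum>s\<in>P. uniform Q s) = of_nat (card (P \<inter> Q)) / of_real (sqrt (card Q))"
    unfolding uniform_def sum_divide_distrib[symmetric] by (simp add: sum.If_cases of_bool_def)
  then show ?thesis
    using braket_uniform[OF assms] by simp
qed

lemma braket_sum_left:
  "braket D X (\<lambda>s. \<Sum>k\<in>K. a k * u k s) v = (\<Sum>k\<in>K. cnj (a k) * braket D X (u k) v)"
  unfolding braket_def cnj_sum sum_distrib_left sum_distrib_right
  by (subst sum.swap) (simp add: mult_ac)

lemma braket_sum_right:
  "braket D X u (\<lambda>s. \<Sum>l\<in>L. b l * v l s) = (\<Sum>l\<in>L. b l * braket D X u (v l))"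
  unfolding braket_def sum_distrib_left
  by (subst sum.swap) (simp add: mult_ac)

lemma op_apply_sum:
  "op_apply D X F (\<lambda>s. \<Sum>l\<in>L. b l * v l s) = (\<lambda>s. \<Sum>l\<in>L. b l * op_apply D X F (v l) s)"
  unfolding op_apply_def sum_distrib_left
  by (subst sum.swap) (simp add: mult_ac)

text \<open>Shifting by a scalar preserves all relations between orthogonal vectors. The term
  \<open>of_bool (s = t)\<close> differs from \<open>id_op\<close> only off the configurations,
  where neither sum looks.\<close>

lemma braket_op_apply_minus_scalar:
  assumes "finite X"
  shows "braket D X u (op_apply D X (\<lambda>s t. F s t - c * of_bool (s = t)) v)
    = braket D X u (op_apply D X F v) - c * braket D X u v"
proof -
  have "op_apply D X (\<lambda>s t. F s t - c * of_bool (s = t)) v s = op_apply D X F v s - c * v s"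
    if s: "s \<in> configs D X" for s
  proof -
    have "(\<Sum>t\<in>configs D X. c * of_bool (s = t) * v t) = (\<Sum>t\<in>configs D X. if s = t then c * v t else 0)"
      by (intro sum.cong) auto
    then show ?thesis
      using assms s by (simp add: op_apply_def left_diff_distrib sum_subtractf sum.delta)
  qed
  then show ?thesis
    unfolding braket_def sum_distrib_left sum_subtractf[symmetric]
    by (intro sum.cong refl) (simp add: right_diff_distrib mult.left_commute)
qed

lemma cfg_image_block_subset:
  "2 \<le> d \<Longrightarrow> i < d \<Longrightarrow> j < d \<Longrightarrow> cfg p ` block d i j \<subseteq> configs (\<lambda>_. d) UNIV"
  using block_subset[of i d j] by auto

lemma block_nonempty: "block d i j \<noteq> {}"
  by (simp add: block_def)

section \<open>Orthogonality of the Fourier states\<close>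

locale fourier_states =
  fixes d :: nat and \<alpha> :: "nat \<Rightarrow> party cvect"
  assumes d2: "2 \<le> d"
    and alpha_0: "\<alpha> 0 = ket 0 0 0"
    and alpha_bij: "bij_betw \<alpha> {1..d\<^sup>2} (B1 \<union> B2 d \<union> B3 d \<union> B4 d \<union> B5 d)"
begin

abbreviation C :: "party config set" where "C \<equiv> configs (\<lambda>_. d) UNIV"
abbreviation ip :: "party cvect \<Rightarrow> party cvect \<Rightarrow> complex" where "ip \<equiv> braket (\<lambda>_. d) UNIV"
abbreviation app :: "party coper \<Rightarrow> party cvect \<Rightarrow> party cvect" where "app \<equiv> op_apply (\<lambda>_. d) UNIV"
abbreviation \<psi> :: "nat \<Rightarrow> party cvect" where "\<psi> \<equiv> fourier_state d \<alpha>"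

lemma alpha_cases:
  assumes "k \<in> {1..d\<^sup>2}"
  obtains i j where "i < d" "j < d" "\<alpha> k = uniform (cfg Alice ` block d i j)"
  using bij_betwE[OF alpha_bij] assms unfolding states_eq_uniform[OF d2] by blast

lemma alpha_block:
  assumes "i < d" "j < d"
  obtains k where "k \<in> {1..d\<^sup>2}" "\<alpha> k = uniform (cfg p ` block d i j)"
  using uniform_cfg_block_in_states[OF d2 assms, of p] bij_betw_imp_surj_on[OF alpha_bij]
  by (metis imageE)

lemma alpha_0_eq: "\<alpha> 0 = uniform {cfg p (0, 0, 0)}"
proof -
  have "cfg p (0, 0, 0) = cfg Alice (0, 0, 0)"
    by (cases p) (simp_all add: cfg.simps)
  then show ?thesis
    by (simp add: alpha_0 ket_eq uniform_def)
qed

lemma d_pos: "0 < d"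
  using d2 by simp

lemma inner_alpha:
  assumes "k \<in> {1..d\<^sup>2}" "l \<in> {1..d\<^sup>2}"
  shows "ip (\<alpha> k) (\<alpha> l) = of_bool (k = l)"
proof -
  obtain i j i' j' where less: "i < d" "j < d" "i' < d" "j' < d"
    and k: "\<alpha> k = uniform (cfg Alice ` block d i j)" and l: "\<alpha> l = uniform (cfg Alice ` block d i' j')"
    using assms alpha_cases by metis
  have eq: "ip (\<alpha> k) (\<alpha> l) = of_nat (card (cfg Alice ` (block d i j \<inter> block d i' j')))
      / (of_real (sqrt (card (block d i j))) * of_real (sqrt (card (block d i' j'))))"
    unfolding k l using cfg_image_block_subset[OF d2 less(1,2)]
    by (subst braket_uniform_uniform) (simp_all add: image_Int[OF inj_cfg])
  show ?thesis
  proof (cases "k = l")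
    case True
    then have "ip (\<alpha> k) (\<alpha> l) = ip (uniform (cfg Alice ` block d i j)) (uniform (cfg Alice ` block d i j))"
      using k by simp
    also have "\<dots> = 1"
      using cfg_image_block_subset[OF d2 less(1,2), of Alice] block_nonempty[of d i j]
      by (simp add: braket_uniform_uniform flip: of_real_mult)
    finally show ?thesis
      using True by simp
  next
    case False
    then have "\<alpha> k \<noteq> \<alpha> l"
      using assms alpha_bij by (metis bij_betw_def inj_onD)
    then have "(i, j) \<noteq> (i', j')"
      using k l by auto
    then have "block d i j \<inter> block d i' j' = {}"
      using block_disjoint[OF less] by blast
    then show ?thesis
      using False eq by simp
  qed
qed

lemma inner_alpha_0:
  assumes "k \<in> {1..d\<^sup>2}"
  shows "ip (\<alpha> 0) (\<alpha> k) = 0" "ip (\<alpha> k) (\<alpha> 0) = 0" "ip (\<alpha> 0) (\<alpha> 0) = 1"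
proof -
  obtain i j where less: "i < d" "j < d" and k: "\<alpha> k = uniform (cfg Alice ` block d i j)"
    using assms alpha_cases by metis
  have "(0, 0, 0) \<notin> block d i j"
    using fst_tail[of "(0, 0, 0)" d i j] by (auto simp: block_def)
  then have "cfg Alice (0, 0, 0) \<notin> cfg Alice ` block d i j"
    by auto
  then show "ip (\<alpha> 0) (\<alpha> k) = 0" "ip (\<alpha> k) (\<alpha> 0) = 0" "ip (\<alpha> 0) (\<alpha> 0) = 1"
    unfolding k alpha_0_eq[of Alice] using cfg_image_block_subset[OF d2 less, of Alice] d_pos
    by (simp_all add: braket_uniform_uniform)
qed

lemma psi_0: "\<psi> 0 = \<alpha> 0"
  by (simp add: fourier_state_def)

lemma psi_pos: "i \<in> {1..d\<^sup>2} \<Longrightarrow> \<psi> i = (\<lambda>s. \<Sum>j = 1..d\<^sup>2. omega (d\<^sup>2) ^ (i * j) * \<alpha> j s)"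
  by (simp add: fourier_state_def)

text \<open>Orthonormality of the \<open>\<alpha> k\<close> reduces the bracket to a product of two
  rows of the Fourier matrix, evaluated by \<open>sum_omega\<close>.\<close>

lemma inner_psi:
  assumes "i \<in> {0..d\<^sup>2}" "j \<in> {0..d\<^sup>2}"
  shows "ip (\<psi> i) (\<psi> j) = (if i \<noteq> j then 0 else if i = 0 then 1 else of_nat (d\<^sup>2))"
proof -
  have one: "1 \<in> {1..d\<^sup>2}"
    using d_pos by simp
  consider "i = 0" "j = 0" | "i = 0" "j \<in> {1..d\<^sup>2}" | "i \<in> {1..d\<^sup>2}" "j = 0"
    | "i \<in> {1..d\<^sup>2}" "j \<in> {1..d\<^sup>2}"
    using assms by fastforce
  then show ?thesis
  proof cases
    case 1
    then show ?thesis
      using inner_alpha_0(3)[OF one] by (simp add: psi_0)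
  next
    case 2
    then show ?thesis
      by (simp add: psi_0 psi_pos braket_sum_right inner_alpha_0)
  next
    case 3
    then show ?thesis
      by (simp add: psi_0 psi_pos braket_sum_left inner_alpha_0)
  next
    case 4
    have "ip (\<psi> i) (\<psi> j) = (\<Sum>k = 1..d\<^sup>2. \<Sum>l = 1..d\<^sup>2.
        if l = k then cnj (omega (d\<^sup>2) ^ (i * k)) * omega (d\<^sup>2) ^ (j * l) else 0)"
      unfolding psi_pos[OF 4(1)] psi_pos[OF 4(2)] braket_sum_left braket_sum_right sum_distrib_left
      by (intro sum.cong refl) (simp add: inner_alpha)
    also have "\<dots> = (\<Sum>k = 1..d\<^sup>2. cnj (omega (d\<^sup>2) ^ (i * k)) * omega (d\<^sup>2) ^ (j * k))"
      by (intro sum.cong refl) (simp add: sum.delta)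
    finally show ?thesis
      using sum_omega[OF 4] 4 by simp
  qed
qed

lemma uniform_in_hilbert: "P \<subseteq> configs D X \<Longrightarrow> uniform P \<in> hilbert D X"
  by (auto simp: uniform_def hilbert_def)

lemma psi_in_hilbert:
  assumes "i \<in> {0..d\<^sup>2}"
  shows "\<psi> i \<in> hilbert (\<lambda>_. d) UNIV"
proof (cases "i = 0")
  case True
  then show ?thesis
    using d_pos by (simp add: psi_0 alpha_0_eq[of Alice] uniform_in_hilbert)
next
  case False
  have "\<alpha> k \<in> hilbert (\<lambda>_. d) UNIV" if "k \<in> {1..d\<^sup>2}" for k
    using that cfg_image_block_subset[OF d2] by (metis alpha_cases uniform_in_hilbert)
  then show ?thesis
    using False assms by (auto simp: psi_pos hilbert_def)
qed

text \<open>Gives the cardinality, and translates distinct states, as in \<open>oplm\<close>, into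
  distinct indices, as in the Fourier argument.\<close>

lemma inj_on_psi: "inj_on \<psi> {0..d\<^sup>2}"
proof (rule inj_onI, rule ccontr)
  fix i j assume "i \<in> {0..d\<^sup>2}" "j \<in> {0..d\<^sup>2}" "\<psi> i = \<psi> j" "i \<noteq> j"
  then show False
    using inner_psi[of i j] inner_psi[of j j] d_pos by (auto split: if_splits)
qed

lemma psi_orthogonal_states: "orthogonal_states (\<lambda>_. d) (\<psi> ` {0..d\<^sup>2})"
  unfolding orthogonal_states_def
proof (intro conjI ballI impI)
  fix \<phi> assume "\<phi> \<in> \<psi> ` {0..d\<^sup>2}"
  then obtain i where i: "i \<in> {0..d\<^sup>2}" "\<phi> = \<psi> i"
    by blast
  then show "\<phi> \<in> hilbert (\<lambda>_. d) UNIV"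
    using psi_in_hilbert by simp
  show "\<phi> \<noteq> (\<lambda>s. 0)"
    using inner_psi[OF i(1) i(1)] d_pos by (auto simp: i(2) braket_def split: if_splits)
  fix \<phi>' assume "\<phi>' \<in> \<psi> ` {0..d\<^sup>2}" "\<phi> \<noteq> \<phi>'"
  then show "ip \<phi> \<phi>' = 0"
    using i inner_psi by auto
qed

section \<open>Rigidity of orthogonality-preserving local operators\<close>

text \<open>\<open>local0\<close> and \<open>local1\<close> say that \<open>F\<close> is the
  identity on \<open>p\<close> tensored with an operator on the other two parties, without naming
  that operator; one statement thus serves every \<open>X\<close> that omits
  \<open>p\<close>.\<close>

lemma local_operator_scalar:
  assumes orth: "\<And>i j. i \<in> {0..d\<^sup>2} \<Longrightarrow> j \<in> {0..d\<^sup>2} \<Longrightarrow> i \<noteq> j \<Longrightarrow> ip (\<psi> i) (app F (\<psi> j)) = 0"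
    and local0: "\<And>s t. s \<in> C \<Longrightarrow> t \<in> C \<Longrightarrow> s p \<noteq> t p \<Longrightarrow> F s t = 0"
    and local1: "\<And>s t a. s \<in> C \<Longrightarrow> t \<in> C \<Longrightarrow> s p = t p \<Longrightarrow> a < d \<Longrightarrow> F (s(p := a)) (t(p := a)) = F s t"
  obtains c where "\<And>s t. s \<in> C \<Longrightarrow> t \<in> C \<Longrightarrow> F s t = (if s = t then c else 0)"
proof -
  let ?o = "cfg p (0, 0, 0)"
  have o: "?o \<in> C"
    using d_pos by simp
  note subset = cfg_image_block_subset[OF d2, of _ _ p]
  have less: "a < d \<and> b < d \<and> c < d" if "(a, b, c) \<in> block d i j" "i < d" "j < d" for a b c i j
    using block_subset[OF that(2,3) d2] that(1) by auto
  have row0: "ip (\<alpha> 0) (app F (\<alpha> l)) = 0" if "l \<in> {1..d\<^sup>2}" for l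
  proof (rule dft_inj[OF _ that])
    fix i assume i: "i \<in> {1..d\<^sup>2}"
    then show "(\<Sum>l = 1..d\<^sup>2. omega (d\<^sup>2) ^ (i * l) * ip (\<alpha> 0) (app F (\<alpha> l))) = 0"
      using orth[of 0 i] by (simp add: psi_0 psi_pos op_apply_sum braket_sum_right)
  qed
  \<comment> \<open>\<open>F\<close> is not assumed Hermitian, so the column needs its own
    inversion, with the conjugate transform.\<close>
  have col0: "ip (\<alpha> l) (app F (\<alpha> 0)) = 0" if "l \<in> {1..d\<^sup>2}" for l
  proof (rule dft_cnj_inj[OF _ that])
    fix i assume i: "i \<in> {1..d\<^sup>2}"
    then show "(\<Sum>l = 1..d\<^sup>2. cnj (omega (d\<^sup>2) ^ (i * l)) * ip (\<alpha> l) (app F (\<alpha> 0))) = 0"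
      using orth[of i 0] by (simp add: psi_0 psi_pos braket_sum_left)
  qed
  have corner: "F ?o (cfg p (0, b, c)) = 0" "F (cfg p (0, b, c)) ?o = 0"
    if bc: "b < d" "c < d" "(b, c) \<noteq> (0, 0)" for b c
  proof -
    obtain k where k: "k \<in> {1..d\<^sup>2}" "\<alpha> k = uniform (cfg p ` block d b c)"
      using alpha_block[OF bc(1,2)] by blast
    have block: "block d b c = insert (0, b, c) (tail d b c)"
      using bc(3) by (auto simp: block_def)
    then have fin: "finite (tail d b c)"
      using finite_block[of d b c] by simp
    have notin: "(0, b, c) \<notin> tail d b c"
      using fst_tail by fastforce
    \<comment> \<open>Here \<open>p\<close> carries a nonzero label, against 0 in \<open>?o\<close>,
      so locality applies.\<close>
    have tail: "F ?o (cfg p x) = 0 \<and> F (cfg p x) ?o = 0" if x: "x \<in> tail d b c" for x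
    proof -
      obtain a' b' c' where x': "x = (a', b', c')"
        by (cases x)
      then show ?thesis
        using less[of a' b' c' b c] bc(1,2) x block fst_tail[OF x] o by (auto intro!: local0)
    qed
    have inj: "inj_on (cfg p) T" for T
      using inj_cfg inj_on_subset by blast
    have sum: "(\<Sum>t\<in>cfg p ` block d b c. f t) = f (cfg p (0, b, c)) + (\<Sum>x\<in>tail d b c. f (cfg p x))"
      for f :: "party config \<Rightarrow> complex"
      unfolding sum.reindex[OF inj] block using fin notin by simp
    have card: "card (block d b c) \<noteq> 0"
      using block_nonempty by simp
    have "(\<Sum>t\<in>cfg p ` block d b c. F ?o t) = 0"
      using row0[OF k(1)] card subset[OF bc(1,2)] o
      by (simp add: k(2) alpha_0_eq[of p] braket_uniform op_apply_uniform)
    then show "F ?o (cfg p (0, b, c)) = 0"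
      using tail by (simp add: sum)
    have "(\<Sum>t\<in>cfg p ` block d b c. F t ?o) = 0"
      using col0[OF k(1)] card subset[OF bc(1,2)] o
      by (simp add: k(2) alpha_0_eq[of p] braket_uniform op_apply_uniform)
    then show "F (cfg p (0, b, c)) ?o = 0"
      using tail by (simp add: sum)
  qed
  define c where "c = F ?o ?o"
  define H where "H s t = F s t - c * of_bool (s = t)" for s t
  \<comment> \<open>The factor of \<open>H\<close> on the other two parties, read off at label 0 of
    \<open>p\<close>.\<close>
  define g where "g b c b' c' = H (cfg p (0, b, c)) (cfg p (0, b', c'))" for b c b' c'
  have H_cfg: "H (cfg p (a, b, c)) (cfg p (a', b', c')) = (if a = a' then g b c b' c' else 0)"
    if "a < d" "b < d" "c < d" "a' < d" "b' < d" "c' < d" for a b c a' b' c'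
    using that local0[of "cfg p (a, b, c)" "cfg p (a', b', c')"]
      local1[of "cfg p (a, b, c)" "cfg p (a', b', c')" 0]
    by (auto simp: H_def g_def fun_upd_cfg)
  have g0: "g 0 0 b c' = 0" "g b c' 0 0 = 0" if "b < d" "c' < d" for b c'
    using corner[OF that] by (auto simp: g_def H_def c_def)
  \<comment> \<open>The state with label 1 at \<open>p\<close> and 0 elsewhere. Its row in
    \<open>H\<close> is a copy of the row of \<open>g\<close> at \<open>(0, 0)\<close>, so it is the
    zero row that \<open>dft_matrix_eq_0\<close> requires.\<close>
  obtain r where r: "r \<in> {1..d\<^sup>2}" "\<alpha> r = uniform (cfg p ` block d 0 0)"
    using alpha_block[OF d_pos d_pos] by blast
  have "H (cfg p (1, 0, 0)) t = 0" if "t \<in> C" for t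
    using that d2 g0 by (cases t rule: cfg_cases[of _ p]) (auto simp: H_cfg)
  then have row: "ip (\<alpha> r) (app H v) = 0" for v
    using d2 unfolding r(2) block_def by (simp add: braket_uniform) (simp add: op_apply_def)
  have "(\<Sum>k = 1..d\<^sup>2. \<Sum>l = 1..d\<^sup>2. cnj (omega (d\<^sup>2) ^ (i * k)) * omega (d\<^sup>2) ^ (j * l)
      * ip (\<alpha> k) (app H (\<alpha> l))) = 0" if ij: "i \<in> {1..d\<^sup>2}" "j \<in> {1..d\<^sup>2}" "i \<noteq> j" for i j
  proof -
    \<comment> \<open>The scalar part contributes nothing because the two states are
      orthogonal.\<close>
    have "ip (\<psi> i) (app H (\<psi> j)) = 0"
      unfolding H_def braket_op_apply_minus_scalar[OF finite]
      using ij orth[of i j] inner_psi[of i j] by simp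
    then show ?thesis
      unfolding psi_pos[OF ij(1)] psi_pos[OF ij(2)] op_apply_sum braket_sum_left braket_sum_right
        sum_distrib_left
      by (simp only: mult.assoc)
  qed
  from dft_matrix_eq_0[OF this r(1) row]
  have alpha_H: "ip (\<alpha> k) (app H (\<alpha> l)) = 0" if "k \<in> {1..d\<^sup>2}" "l \<in> {1..d\<^sup>2}" for k l
    using that by blast
  have blocks: "(\<Sum>x\<in>block d i j. \<Sum>y\<in>block d i' j'. H (cfg p x) (cfg p y)) = 0"
    if ij: "i < d" "j < d" "i' < d" "j' < d" for i j i' j'
  proof -
    obtain k where k: "k \<in> {1..d\<^sup>2}" "\<alpha> k = uniform (cfg p ` block d i j)"
      using alpha_block[OF ij(1,2)] by blast
    obtain l where l: "l \<in> {1..d\<^sup>2}" "\<alpha> l = uniform (cfg p ` block d i' j')"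
      using alpha_block[OF ij(3,4)] by blast
    have inj: "inj_on (cfg p) T" for T
      using inj_cfg inj_on_subset by blast
    have card: "card (block d i j) \<noteq> 0" for i j
      using block_nonempty by simp
    show ?thesis
      using alpha_H[OF k(1) l(1)] card subset[OF ij(1,2)] subset[OF ij(3,4)]
      by (simp add: k(2) l(2) braket_uniform op_apply_uniform sum.reindex[OF inj] flip: sum_divide_distrib)
  qed
  have g: "g i j i' j' = 0" if ij: "i < d" "j < d" "i' < d" "j' < d" for i j i' j'
  proof (rule block_sums_eq_0[of d g, OF _ g0 ij])
    show "(\<Sum>x\<in>block d i j. \<Sum>y\<in>block d i' j'.
        (\<lambda>(a, b, c) (a', b', c'). if a = a' then g b c b' c' else 0) x y) = 0"
      if ij: "i < d" "j < d" "i' < d" "j' < d" for i j i' j'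
    proof (rule trans[OF _ blocks[OF ij]], intro sum.cong refl)
      show "(\<lambda>(a, b, c) (a', b', c'). if a = a' then g b c b' c' else 0) x y = H (cfg p x) (cfg p y)"
        if "x \<in> block d i j" "y \<in> block d i' j'" for x y
        using that less ij by (cases x; cases y) (auto simp: H_cfg)
    qed
  qed
  show ?thesis
  proof (rule that)
    fix s t assume st: "s \<in> C" "t \<in> C"
    have "H s t = 0"
      using st g by (cases s rule: cfg_cases[of _ p]; cases t rule: cfg_cases[of _ p]) (auto simp: H_cfg)
    then show "F s t = (if s = t then c else 0)"
      by (simp add: H_def split: if_splits)
  qed
qed

text \<open>A party \<open>p\<close> outside \<open>X\<close> sees only the identity factor of the
  extended operator \<open>F\<close>, so \<open>F\<close> is scalar; restricting back to
  \<open>X\<close> makes \<open>E m\<close> scalar.\<close>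

lemma oplm_trivial:
  assumes X: "X \<noteq> UNIV" and oplm: "oplm (\<lambda>_. d) (\<psi> ` {0..d\<^sup>2}) X n E"
  shows "trivial_povm (\<lambda>_. d) X n E"
  unfolding trivial_povm_def
proof (intro allI impI)
  fix m assume m: "m < n"
  obtain p where p: "p \<notin> X"
    using X by blast
  define F where "F = tensor_op (\<lambda>_. d) (- X) (id_op (\<lambda>_. d) (- X)) X (E m)"
  have E: "E m \<in> operators (\<lambda>_. d) X"
    using oplm m by (simp add: oplm_def povm_def positive_semidefinite_def)
  have orth: "ip (\<psi> i) (app F (\<psi> j)) = 0" if "i \<in> {0..d\<^sup>2}" "j \<in> {0..d\<^sup>2}" "i \<noteq> j" for i j
    using oplm m that inj_onD[OF inj_on_psi, of i j] unfolding oplm_def F_def by blast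
  have restrict: "restrict s Y \<in> configs (\<lambda>_. d) Y" if "s \<in> C" for s Y
    using that by (auto simp: configs_def)
  have F: "F s t = (if restrict s (- X) = restrict t (- X) then E m (restrict s X) (restrict t X) else 0)"
    if "s \<in> C" "t \<in> C" for s t
    using that restrict by (simp add: F_def tensor_op_def id_op_def)
  have upd: "s(p := a) \<in> C" if "s \<in> C" "a < d" for s a
    using that by (auto simp: configs_UNIV)
  obtain c where c: "\<And>s t. s \<in> C \<Longrightarrow> t \<in> C \<Longrightarrow> F s t = (if s = t then c else 0)"
  proof (rule local_operator_scalar[OF orth])
    show "F s t = 0" if "s \<in> C" "t \<in> C" "s p \<noteq> t p" for s t
    proof -
      have "restrict s (- X) p \<noteq> restrict t (- X) p"
        using p that by simp
      then have "restrict s (- X) \<noteq> restrict t (- X)"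
        by metis
      then show ?thesis
        using that by (simp add: F)
    qed
    show "F (s(p := a)) (t(p := a)) = F s t" if "s \<in> C" "t \<in> C" "s p = t p" "a < d" for s t a
    proof -
      have "restrict (s(p := a)) (- X) = restrict (t(p := a)) (- X) \<longleftrightarrow> restrict s (- X) = restrict t (- X)"
        using that(3) by (auto simp: fun_eq_iff restrict_def)
      then show ?thesis
        using that p by (simp add: F upd restrict_fupd)
    qed
  qed auto
  have "E m s t = c * id_op (\<lambda>_. d) X s t" for s t
  proof (cases "s \<in> configs (\<lambda>_. d) X \<and> t \<in> configs (\<lambda>_. d) X")
    case True
    \<comment> \<open>Padding with label 0 outside \<open>X\<close> makes any two extensions agree
      there, so the identity factor contributes 1 and \<open>F\<close> returns the entry of
      \<open>E m\<close>.\<close>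
    define ext :: "party config \<Rightarrow> party config" where "ext s = (\<lambda>q. if q \<in> X then s q else 0)" for s
    have ext: "ext s \<in> C" "restrict (ext s) X = s" if "s \<in> configs (\<lambda>_. d) X" for s
      using that d_pos by (auto simp: ext_def configs_def PiE_def extensional_def restrict_def fun_eq_iff)
    have "restrict (ext s) (- X) = restrict (ext t) (- X)"
      by (auto simp: ext_def restrict_def)
    then have "E m s t = F (ext s) (ext t)"
      using True by (simp add: F ext)
    also have "\<dots> = (if s = t then c else 0)"
      using True c ext by metis
    finally show ?thesis
      using True by (simp add: id_op_def)
  next
    case False
    then have "E m s t = 0"
      using E by (auto simp: operators_def)
    then show ?thesis
      using False by (auto simp: id_op_def)
  qed
  then show "\<exists>c. E m = (\<lambda>s t. c * id_op (\<lambda>_. d) X s t)"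
    by blast
qed

end

theorem theorem1:
  fixes d :: nat and \<alpha> :: "nat \<Rightarrow> party cvect"
  assumes "d \<ge> 2"
    and "\<alpha> 0 = ket 0 0 0"
    and "bij_betw \<alpha> {1..d\<^sup>2} (B1 \<union> B2 d \<union> B3 d \<union> B4 d \<union> B5 d)"
    and "\<alpha> 1 = ket 1 0 0"
    and "\<alpha> 2 = ket 0 0 1"
    and "\<alpha> 3 = ket 0 1 0"
  shows "strongest_nonlocal (\<lambda>_. d) (fourier_state d \<alpha> ` {0..d\<^sup>2}) \<and>
         card (fourier_state d \<alpha> ` {0..d\<^sup>2}) = d\<^sup>2 + 1"
proof -
  interpret fourier_states d \<alpha>
    using assms(1-3) by unfold_locales
  show ?thesis
    using psi_orthogonal_states oplm_trivial card_image[OF inj_on_psi]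
    unfolding strongest_nonlocal_def by simp
qed

end
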